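(* Let $\lambda>0$, $0<k\le 1$, let $X_{\lambda,k}$ be a Weibull random variable with parameters $\lambda$ and $k$, and let $Z$ be a standard normal random variable. Then $$P\left\{|X_{\lambda,k}-E[X_{\lambda,k}]|\le \sqrt{\mathrm{Var}(X_{\lambda,k})}\right\}>P\{|Z|\le 1\}\approx 0.6827.$$
   Context: A Weibull random variable with parameters $\lambda>0$ (scale) and $k>0$ (shape) has cumulative distribution function $P\{X_{\lambda,k}\le x\}=1-e^{-(x/\lambda)^k}$ for $x\ge 0$ (and $0$ for $x<0$). The symbol $\approx$ means equality after rounding to the number of decimals displayed. *)

theory Defs
  imports "HOL-Probability.Probability"
begin

(* l is the scale and k the shape *)
definition weibull_distributed :: "'a measure \<Rightarrow> ('a \<Rightarrow> real) \<Rightarrow> real \<Rightarrow> real \<Rightarrow> bool" where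
  "weibull_distributed M X l k \<longleftrightarrow>
     X \<in> borel_measurable M \<and>
     (\<forall>x. \<P>(\<omega> in M. X \<omega> \<le> x) = (if x < 0 then 0 else 1 - exp (- ((x / l) powr k))))"

(* y is the decimal with d digits after the point obtained by rounding x *)
definition rounds_to :: "nat \<Rightarrow> real \<Rightarrow> real \<Rightarrow> bool" where
  "rounds_to d x y \<longleftrightarrow> real_of_int (round (x * 10 ^ d)) / 10 ^ d = y"

end

theory Submission
  imports Defs
begin

text \<open>
  With \<open>a = 1 / k \<ge> 1\<close>, the variable \<open>(X / l)\<^sup>k\<close> is standard exponential, so \<open>X\<close> has mean
  \<open>\<mu> = l \<Gamma>(1 + a)\<close> and second moment \<open>l\<^sup>2 \<Gamma>(1 + 2a)\<close>. Since \<open>B(a, a) \<le> B(a, 1) = 1 / a\<close>, we have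
  \<open>\<Gamma>(1 + 2a) \<ge> 2 \<Gamma>(1 + a)\<^sup>2\<close>, that is, the standard deviation \<open>\<sigma>\<close> is at least \<open>\<mu>\<close>. The event
  therefore contains \<open>0 < X \<le> 2\<mu>\<close>, of probability \<open>1 - exp (- (2 \<Gamma>(1 + a))\<^sup>1\<^sup>/\<^sup>a)\<close>. Log-convexity of
  \<open>\<Gamma>\<close> gives \<open>2 \<Gamma>(1 + a) \<ge> 2\<^sup>a\<^sup>/\<^sup>2\<close>, so this probability is at least \<open>1 - exp (- sqrt 2) > 0.7\<close>,
  while Taylor polynomials of the exponential function enclose the normal probability between
  \<open>0.68265\<close> and \<open>0.68275\<close>.
\<close>

section \<open>Lower bounds for the Gamma function\<close>

lemma Gamma_double_ge:
  fixes a :: real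
  assumes "a \<ge> 1"
  shows "Gamma (1 + 2 * a) \<ge> 2 * (Gamma (1 + a))\<^sup>2"
proof -
  \<comment> \<open>On (0,1) the integrand t^(a-1) (1-t)^(b-1) of B(a,b) decreases in b, and
    \<open>a \<ge> 1\<close>.\<close>
  have "Beta a a \<le> Beta a 1"
    using assms by (intro Beta_real_mono) auto
  moreover have G1: "Gamma (1 + a) = a * Gamma a" "Gamma (1 + 2 * a) = 2 * a * Gamma (2 * a)"
    using assms Gamma_plus1[of a] Gamma_plus1[of "2 * a"]
    by (auto simp: add.commute nonpos_Ints_def)
  moreover have pos: "Gamma a > 0" "Gamma (2 * a) > 0"
    using assms by (auto intro!: Gamma_real_pos)
  ultimately have "(Gamma a)\<^sup>2 / Gamma (2 * a) \<le> 1 / a"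
    by (simp add: Beta_def power2_eq_square add.commute)
  then have "a * (Gamma a)\<^sup>2 \<le> Gamma (2 * a)"
    using pos assms by (simp add: field_simps)
  then have "2 * a * (a * (Gamma a)\<^sup>2) \<le> 2 * a * Gamma (2 * a)"
    using assms by (intro mult_left_mono) auto
  then show ?thesis
    unfolding G1 by (simp add: power2_eq_square mult_ac)
qed

text \<open>Log-convexity at \<open>c + 1\<close>, a convex combination of \<open>c\<close> and
  \<open>x\<close> with weight 1/(x-c) on \<open>x\<close>; multiplying by \<open>x - c\<close>
  clears the denominator. For \<open>c\<close> = 1 or 2 the term \<open>ln (Gamma c)\<close>
  vanishes, leaving a lower bound for \<open>Gamma x\<close>.\<close>

lemma ln_Gamma_plus1_le:
  fixes c x :: real
  assumes "0 < c" and "c + 1 \<le> x"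
  shows "(x - c) * ln (Gamma (c + 1)) \<le> (x - c - 1) * ln (Gamma c) + ln (Gamma x)"
proof -
  define w where "w = 1 / (x - c)"
  have w: "0 \<le> w" "w \<le> 1" "w * (x - c) = 1"
    using assms by (auto simp: w_def)
  have "(1 - w) * c + w * x = c + w * (x - c)"
    by (simp add: algebra_simps)
  then have "ln (Gamma (c + 1)) \<le> (1 - w) * ln (Gamma c) + w * ln (Gamma x)"
    using convex_onD[OF log_convex_Gamma_real w(1,2), of c x] assms w(3) by simp
  then have "(x - c) * ln (Gamma (c + 1)) \<le> (x - c) * ((1 - w) * ln (Gamma c) + w * ln (Gamma x))"
    using assms by (intro mult_left_mono) auto
  also have "\<dots> = (x - c - w * (x - c)) * ln (Gamma c) + (w * (x - c)) * ln (Gamma x)"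
    by (simp add: algebra_simps)
  finally show ?thesis
    by (simp add: w(3))
qed

lemma Gamma_ge_one:
  fixes x :: real
  assumes "x \<ge> 2"
  shows "Gamma x \<ge> 1"
proof -
  have "Gamma 2 = (1 :: real)"
    using Gamma_fact[of 1, where 'a = real] by simp
  then have "0 \<le> ln (Gamma x)"
    using ln_Gamma_plus1_le[of 1 x] assms by simp
  moreover have "Gamma x > 0"
    using assms by (intro Gamma_real_pos) auto
  ultimately show ?thesis
    by simp
qed

lemma Gamma_ge_powr:
  fixes x :: real
  assumes "x \<ge> 3"
  shows "Gamma x \<ge> 2 powr (x - 2)"
proof -
  have "Gamma 2 = (1 :: real)" "Gamma 3 = (2 :: real)"
    using Gamma_fact[of 1, where 'a = real] Gamma_fact[of 2, where 'a = real] by simp_all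
  then have "(x - 2) * ln 2 \<le> ln (Gamma x)"
    using ln_Gamma_plus1_le[of 2 x] assms by simp
  moreover have "Gamma x > 0"
    using assms by (intro Gamma_real_pos) auto
  ultimately show ?thesis
    by (simp add: powr_def ln_ge_iff)
qed

text \<open>The exponent \<open>a / 2\<close> is chosen so that, for \<open>a = 1 / k\<close>,
  raising to the power \<open>k\<close> yields \<open>sqrt 2\<close>, free of \<open>k\<close>. The
  split at 2 is where \<open>Gamma_ge_powr\<close> starts to apply to \<open>1 + a\<close>; below
  it, 2^(a/2) is at most 2 and \<open>Gamma (1 + a) \<ge> 1\<close> suffices.\<close>

lemma two_Gamma_ge:
  fixes a :: real
  assumes "a \<ge> 1"
  shows "2 * Gamma (1 + a) \<ge> 2 powr (a / 2)"
proof (cases "a \<ge> 2")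
  case True
  have "2 powr (a / 2) \<le> 2 powr (1 + (a - 1) :: real)"
    using True by (intro powr_mono) auto
  also have "\<dots> = 2 * 2 powr (a - 1)"
    by (simp only: powr_add) simp
  also have "\<dots> \<le> 2 * Gamma (1 + a)"
    using Gamma_ge_powr[of "1 + a"] True by simp
  finally show ?thesis .
next
  case False
  have "2 powr (a / 2) \<le> 2 powr (1 :: real)"
    using False by (intro powr_mono) auto
  also have "\<dots> \<le> 2 * Gamma (1 + a)"
    using Gamma_ge_one[of "1 + a"] assms by simp
  finally show ?thesis .
qed

section \<open>Weibull moments via the exponential distribution\<close>

lemma (in prob_space) exponential_distributed_powr_moment:
  assumes D: "distributed M lborel Y (exponential_density 1)" and "s > -1"
  shows "has_bochner_integral M (\<lambda>\<omega>. Y \<omega> powr s) (Gamma (1 + s))"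
proof (rule has_bochner_integral_nn_integral)
  have [measurable]: "Y \<in> borel_measurable M"
    using distributed_measurable[OF D] by simp
  show "(\<lambda>\<omega>. Y \<omega> powr s) \<in> borel_measurable M"
    by measurable
  have "(\<integral>\<^sup>+\<omega>. ennreal (Y \<omega> powr s) \<partial>M)
      = (\<integral>\<^sup>+t. ennreal (exponential_density 1 t) * ennreal (t powr s) \<partial>lborel)"
    by (rule distributed_nn_integral[OF D, symmetric]) measurable
  \<comment> \<open>The exponent is kept as \<open>1 + s - 1\<close> to match Euler's integral for
    \<open>Gamma (1 + s)\<close>.\<close>
  also have "\<dots> = (\<integral>\<^sup>+t. ennreal (indicator {0..} t * t powr (1 + s - 1) / exp t) \<partial>lborel)"
    by (intro nn_integral_cong)
      (auto simp: exponential_density_def ennreal_mult[symmetric] exp_minus field_simps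
        split: split_indicator)
  also have "\<dots> = ennreal (Gamma (1 + s))"
    using \<open>s > -1\<close> by (intro Gamma_conv_nn_integral_real[symmetric]) auto
  finally show "(\<integral>\<^sup>+\<omega>. ennreal (Y \<omega> powr s) \<partial>M) = ennreal (Gamma (1 + s))" .
  show "0 \<le> Gamma (1 + s)"
    using \<open>s > -1\<close> by (intro less_imp_le Gamma_real_pos) auto
qed auto

lemma (in prob_space) weibull_distributed_AE_pos:
  assumes "weibull_distributed M X l k"
  shows "AE \<omega> in M. 0 < X \<omega>"
proof -
  have [measurable]: "X \<in> borel_measurable M"
    using assms by (simp add: weibull_distributed_def)
  \<comment> \<open>At 0 the second branch of the distribution function applies, and
    \<open>0 powr k = 0\<close> gives 1 - exp 0 = 0.\<close>
  have "\<P>(\<omega> in M. X \<omega> \<le> 0) = 0"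
    using assms by (simp add: weibull_distributed_def)
  then have "AE \<omega> in M. \<not> X \<omega> \<le> 0"
    by (subst (asm) prob_eq_0) auto
  then show ?thesis
    by eventually_elim auto
qed

lemma (in prob_space) weibull_distributed_imp_exponential:
  assumes W: "weibull_distributed M X l k" and "l > 0" "k > 0"
  shows "distributed M lborel (\<lambda>\<omega>. (X \<omega> / l) powr k) (exponential_density 1)"
proof (subst exponential_distributed_iff, safe)
  have [measurable]: "X \<in> borel_measurable M"
    using W by (simp add: weibull_distributed_def)
  show "(\<lambda>\<omega>. (X \<omega> / l) powr k) \<in> borel_measurable M"
    by measurable
  fix y :: real assume "0 \<le> y"
  have eq: "(x / l) powr k \<le> y \<longleftrightarrow> x \<le> l * y powr (1 / k)" if "x > 0" for x
  proof -
    have "(x / l) powr k \<le> y \<longleftrightarrow> (x / l) powr k \<le> (y powr (1 / k)) powr k"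
      using \<open>0 \<le> y\<close> \<open>k > 0\<close> by (simp add: powr_powr)
    also have "\<dots> \<longleftrightarrow> x / l \<le> y powr (1 / k)"
      using that \<open>l > 0\<close> \<open>k > 0\<close>
      by (metis divide_pos_pos less_imp_le not_le powr_ge_zero powr_less_mono2 powr_mono2)
    finally show ?thesis
      using \<open>l > 0\<close> by (simp add: field_simps)
  qed
  \<comment> \<open>The two events are compared only almost everywhere, since \<open>eq\<close>
    inverts the power at positive arguments alone.\<close>
  have "\<P>(\<omega> in M. (X \<omega> / l) powr k \<le> y) = \<P>(\<omega> in M. X \<omega> \<le> l * y powr (1 / k))"
    using weibull_distributed_AE_pos[OF W] by (intro prob_eq_AE) (auto simp: eq)
  also have "\<dots> = 1 - exp (- ((l * y powr (1 / k) / l) powr k))"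
    using W \<open>l > 0\<close> by (auto simp: weibull_distributed_def not_less mult_less_0_iff)
  also have "\<dots> = 1 - exp (- y * 1)"
    using \<open>l > 0\<close> \<open>k > 0\<close> \<open>0 \<le> y\<close> by (simp add: powr_powr)
  finally show "\<P>(\<omega> in M. (X \<omega> / l) powr k \<le> y) = 1 - exp (- y * 1)" .
qed simp

text \<open>Almost surely X^n = l^n Y^(n/k) with Y = (X/l)^k standard exponential. The cases
  \<open>n\<close> = 1 and 2 give the mean and the variance.\<close>

lemma (in prob_space) weibull_moment:
  assumes W: "weibull_distributed M X l k" and "l > 0" "k > 0"
  shows "has_bochner_integral M (\<lambda>\<omega>. X \<omega> ^ n) (l ^ n * Gamma (1 + real n / k))"
proof -
  have [measurable]: "X \<in> borel_measurable M"
    using W by (simp add: weibull_distributed_def)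
  have "has_bochner_integral M (\<lambda>\<omega>. l ^ n * ((X \<omega> / l) powr k) powr (real n / k))
      (l ^ n * Gamma (1 + real n / k))"
    using assms
    by (intro has_bochner_integral_mult_right exponential_distributed_powr_moment
          weibull_distributed_imp_exponential) (auto intro: less_le_trans[of _ 0])
  moreover have "AE \<omega> in M. l ^ n * ((X \<omega> / l) powr k) powr (real n / k) = X \<omega> ^ n"
    using weibull_distributed_AE_pos[OF W] assms
    by (auto simp: powr_powr powr_realpow power_divide elim!: eventually_mono)
  ultimately show ?thesis
    by (subst (asm) has_bochner_integral_cong_AE) auto
qed

section \<open>Numerical enclosure of the normal probability\<close>

lemma exp_neg_Taylor_bounds:
  fixes y :: real
  assumes "0 \<le> y"
  shows "1 - y + y^2/2 - y^3/6 + y^4/24 - y^5/120 \<le> exp (- y)"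
    and "exp (- y) \<le> 1 - y + y^2/2 - y^3/6 + y^4/24"
proof -
  \<comment> \<open>The sign of the Lagrange remainder decides the direction: order 6 leaves an even
    power of \<open>- y\<close>, order 5 an odd one.\<close>
  obtain t where "exp (- y) = (\<Sum>m<6. (- y) ^ m / fact m) + (exp t / fact 6) * (- y) ^ 6"
    using Maclaurin_exp_le[of "- y" 6] by blast
  moreover have "(exp t / fact 6) * (- y) ^ 6 \<ge> 0"
    by simp
  moreover have "(\<Sum>m<6. (- y) ^ m / fact m) = 1 - y + y^2/2 - y^3/6 + y^4/24 - y^5/120"
    by (simp add: eval_nat_numeral)
  ultimately show "1 - y + y^2/2 - y^3/6 + y^4/24 - y^5/120 \<le> exp (- y)"
    by linarith
  obtain t where "exp (- y) = (\<Sum>m<5. (- y) ^ m / fact m) + (exp t / fact 5) * (- y) ^ 5"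
    using Maclaurin_exp_le[of "- y" 5] by blast
  moreover have "(exp t / fact 5) * (- y) ^ 5 \<le> 0"
    using assms by (intro mult_nonneg_nonpos) auto
  moreover have "(\<Sum>m<5. (- y) ^ m / fact m) = 1 - y + y^2/2 - y^3/6 + y^4/24"
    by (simp add: eval_nat_numeral)
  ultimately show "exp (- y) \<le> 1 - y + y^2/2 - y^3/6 + y^4/24"
    by linarith
qed

lemma integral_exp_neg_half_square_bounds:
  defines "J \<equiv> (\<integral>x. exp (- x\<^sup>2 / 2) * indicator {-1..1 :: real} x \<partial>lborel)"
  shows "1.71124 \<le> J" and "J \<le> 1.7113"
proof -
  \<comment> \<open>\<open>?p\<close> is the quartic Taylor bound at y = x^2/2 and \<open>?P\<close>
    its antiderivative; the further term x^10/3840 is y^5/120.\<close>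
  let ?p = "\<lambda>x :: real. 1 - x^2/2 + x^4/8 - x^6/48 + x^8/384"
  let ?P = "\<lambda>x :: real. x - x^3/6 + x^5/40 - x^7/336 + x^9/3456"
  have hi: "has_bochner_integral lborel (\<lambda>x. ?p x * indicator {-1..1} x) (?P 1 - ?P (-1))"
    by (rule has_bochner_integral_FTC_Icc_real) (auto intro!: derivative_eq_intros)
  have lo: "has_bochner_integral lborel (\<lambda>x. (?p x - x^10/3840) * indicator {-1..1} x)
      ((?P 1 - 1^11/42240) - (?P (-1) - (-1)^11/42240))"
    by (rule has_bochner_integral_FTC_Icc_real) (auto intro!: derivative_eq_intros)
  have int: "integrable lborel (\<lambda>x. exp (- x\<^sup>2 / 2) * indicator {-1..1 :: real} x)"
    by (rule borel_integrable_atLeastAtMost) (auto intro!: continuous_intros)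
  have ineq: "?p x - x^10/3840 \<le> exp (- x\<^sup>2 / 2)" "exp (- x\<^sup>2 / 2) \<le> ?p x" for x :: real
    using exp_neg_Taylor_bounds[of "x\<^sup>2 / 2"]
    by (simp_all add: power_divide power_mult[symmetric])
  have "(\<integral>x. (?p x - x^10/3840) * indicator {-1..1} x \<partial>lborel) \<le> J"
    unfolding J_def using lo int ineq(1)
    by (intro integral_mono) (auto simp: has_bochner_integral_iff split: split_indicator)
  then show "1.71124 \<le> J"
    using lo by (simp add: has_bochner_integral_iff)
  have "J \<le> (\<integral>x. ?p x * indicator {-1..1} x \<partial>lborel)"
    unfolding J_def using hi int ineq(2)
    by (intro integral_mono) (auto simp: has_bochner_integral_iff split: split_indicator)
  then show "J \<le> 1.7113"
    using hi by (simp add: has_bochner_integral_iff)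
qed

text \<open>These bounds delimit exactly the numbers that round to 0.6827 at four decimals. The
  upper one is strict because \<open>round\<close> sends halves upwards.\<close>

lemma (in prob_space) std_normal_one_sigma_bounds:
  assumes D: "distributed M lborel Z std_normal_density"
  shows "0.68265 \<le> \<P>(\<omega> in M. \<bar>Z \<omega>\<bar> \<le> 1)" and "\<P>(\<omega> in M. \<bar>Z \<omega>\<bar> \<le> 1) < 0.68275"
proof -
  let ?J = "\<integral>x. exp (- x\<^sup>2 / 2) * indicator {-1..1 :: real} x \<partial>lborel"
  have [measurable]: "Z \<in> borel_measurable M"
    using distributed_measurable[OF D] by simp
  have "\<P>(\<omega> in M. \<bar>Z \<omega>\<bar> \<le> 1) = (\<integral>\<omega>. indicator {\<omega>\<in>space M. \<bar>Z \<omega>\<bar> \<le> 1} \<omega> \<partial>M)"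
    by simp
  also have "\<dots> = (\<integral>\<omega>. indicator {-1..1} (Z \<omega>) \<partial>M)"
    by (intro Bochner_Integration.integral_cong) (auto split: split_indicator)
  also have "\<dots> = (\<integral>x. std_normal_density x * indicator {-1..1} x \<partial>lborel)"
    by (rule distributed_integral[OF D, symmetric]) auto
  also have "\<dots> = (\<integral>x. 1 / sqrt (2 * pi) * (exp (- x\<^sup>2 / 2) * indicator {-1..1 :: real} x) \<partial>lborel)"
    by (simp add: std_normal_density_def mult.assoc)
  also have "\<dots> = ?J / sqrt (2 * pi)"
    by (subst integral_mult_right_zero) simp
  finally have eq: "\<P>(\<omega> in M. \<bar>Z \<omega>\<bar> \<le> 1) = ?J / sqrt (2 * pi)" .
  have s: "2.50662 \<le> sqrt (2 * pi)" "sqrt (2 * pi) \<le> 2.50664"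
    using pi_approx
    by (intro real_le_rsqrt real_le_lsqrt; simp add: power2_eq_square)+
  show "0.68265 \<le> \<P>(\<omega> in M. \<bar>Z \<omega>\<bar> \<le> 1)" "\<P>(\<omega> in M. \<bar>Z \<omega>\<bar> \<le> 1) < 0.68275"
    using s integral_exp_neg_half_square_bounds by (auto simp: eq field_simps)
qed

section \<open>The one-sigma probability of the Weibull distribution\<close>

lemma (in prob_space) weibull_one_sigma_ge:
  assumes W: "weibull_distributed M X l k" and "l > 0" "0 < k" "k \<le> 1"
  shows "\<P>(\<omega> in M. \<bar>X \<omega> - expectation X\<bar> \<le> sqrt (variance X)) \<ge> 1 - exp (- sqrt 2)"
proof -
  define a where "a = 1 / k"
  have a: "a \<ge> 1" and ak: "a * k = 1"
    using assms by (auto simp: a_def)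
  have [measurable]: "X \<in> borel_measurable M"
    using W by (simp add: weibull_distributed_def)
  have m1: "integrable M X" "expectation X = l * Gamma (1 + a)"
    and m2: "integrable M (\<lambda>\<omega>. (X \<omega>)\<^sup>2)" "expectation (\<lambda>\<omega>. (X \<omega>)\<^sup>2) = l\<^sup>2 * Gamma (1 + 2 * a)"
    using weibull_moment[OF W \<open>l > 0\<close> \<open>0 < k\<close>, of 1] weibull_moment[OF W \<open>l > 0\<close> \<open>0 < k\<close>, of 2]
    by (auto simp: has_bochner_integral_iff a_def)
  define \<mu> where "\<mu> = expectation X"
  have G: "Gamma (1 + a) > 0"
    using a by (intro Gamma_real_pos) auto
  then have \<mu>: "\<mu> > 0"
    using \<open>l > 0\<close> by (simp add: \<mu>_def m1)
  have "l\<^sup>2 * (2 * (Gamma (1 + a))\<^sup>2) \<le> l\<^sup>2 * Gamma (1 + 2 * a)"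
    using Gamma_double_ge[of a] a by (intro mult_left_mono) auto
  then have "\<mu>\<^sup>2 \<le> variance X"
    by (subst variance_eq[OF m1(1) m2(1)]) (simp add: m1(2) m2(2) \<mu>_def power_mult_distrib)
  then have sd: "\<mu> \<le> sqrt (variance X)"
    by (rule real_le_rsqrt)
  have "sqrt 2 = (2 powr (a / 2)) powr k"
    using ak by (simp add: powr_powr powr_half_sqrt)
  also have "\<dots> \<le> (2 * Gamma (1 + a)) powr k"
    using two_Gamma_ge[OF a] \<open>0 < k\<close> by (intro powr_mono2) auto
  also have "2 * Gamma (1 + a) = 2 * \<mu> / l"
    using \<open>l > 0\<close> by (simp add: \<mu>_def m1)
  finally have "1 - exp (- sqrt 2) \<le> 1 - exp (- ((2 * \<mu> / l) powr k))"
    by simp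
  also have "\<dots> = \<P>(\<omega> in M. X \<omega> \<le> 2 * \<mu>)"
    using W \<mu> by (simp add: weibull_distributed_def)
  also have "\<dots> \<le> \<P>(\<omega> in M. \<bar>X \<omega> - \<mu>\<bar> \<le> sqrt (variance X))"
  proof (rule finite_measure_mono_AE)
    \<comment> \<open>Almost surely X > 0, so X \<le> 2\<mu> puts X within \<mu> of its mean, and
      \<open>sd\<close> bounds \<mu> by the standard deviation.\<close>
    show "AE \<omega> in M. \<omega> \<in> {\<omega> \<in> space M. X \<omega> \<le> 2 * \<mu>} \<longrightarrow>
        \<omega> \<in> {\<omega> \<in> space M. \<bar>X \<omega> - \<mu>\<bar> \<le> sqrt (variance X)}"
      using weibull_distributed_AE_pos[OF W] by eventually_elim (use sd in auto)
  qed measurable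
  finally show ?thesis
    by (simp add: \<mu>_def)
qed

text \<open>The value 0.3 leaves a Weibull probability above 0.7, clear of 0.68275. Its reciprocal
  10/3 lies below the quadratic Taylor value 3.38 of exp at 1.4, and 1.4 \<le>
  \<open>sqrt 2\<close>.\<close>

lemma exp_neg_sqrt_2_less: "exp (- sqrt 2) < (0.3 :: real)"
proof -
  have "10 / 3 < 1 + 1.4 + (1.4 :: real)\<^sup>2 / 2"
    by (simp add: power2_eq_square)
  also have "\<dots> \<le> exp 1.4"
    by (rule exp_lower_Taylor_quadratic) simp
  also have "\<dots> \<le> exp (sqrt 2)"
    by (intro exp_mono real_le_rsqrt) (simp add: power2_eq_square)
  finally show ?thesis
    by (simp add: exp_minus field_simps)
qed

theorem theorem3p1:
  fixes M :: "'a measure" and X :: "'a \<Rightarrow> real"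
    and N :: "'b measure" and Z :: "'b \<Rightarrow> real"
    and l k :: real
  assumes "prob_space M" and "prob_space N"
    and "l > 0" and "0 < k" and "k \<le> 1"
    and "weibull_distributed M X l k"
    and "distributed N lborel Z std_normal_density"
  shows "\<P>(\<omega> in M. \<bar>X \<omega> - prob_space.expectation M X\<bar> \<le> sqrt (prob_space.variance M X))
           > \<P>(\<omega> in N. \<bar>Z \<omega>\<bar> \<le> 1)
         \<and> rounds_to 4 (\<P>(\<omega> in N. \<bar>Z \<omega>\<bar> \<le> 1)) 0.6827"
proof -
  note Z = prob_space.std_normal_one_sigma_bounds[OF assms(2,7)]
  note X = prob_space.weibull_one_sigma_ge[OF assms(1,6,3-5)]
  \<comment> \<open>The scaled probability lies in [6826.5, 6827.5), so adding 1/2 gives floor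
    6827.\<close>
  have "round (\<P>(\<omega> in N. \<bar>Z \<omega>\<bar> \<le> 1) * 10 ^ 4) = 6827"
    using Z unfolding round_def by (intro floor_unique) auto
  then have "rounds_to 4 (\<P>(\<omega> in N. \<bar>Z \<omega>\<bar> \<le> 1)) 0.6827"
    by (simp add: rounds_to_def)
  then show ?thesis
    using X Z exp_neg_sqrt_2_less by auto
qed

end
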